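(* Let $Y$ be a pointed topological space whose distinguished point $*_Y$ has an open neighborhood $U_*\neq Y$. For a non-discrete topological space $X$ with quotient map $q:X\to X/X'$, the following conditions are equivalent: (1) $X$ is a $\dot\mu$-space; (2) the quotient map $q:X\to X/X'$ is compact-covering; (3) the map $q^*:C_k'(X/X',Y)\to C_k'(X,Y)$, $q^*:f\mapsto f\circ q$, is a homeomorphism. Moreover, conditions (1)–(3) follow from the condition (4) $X$ is a $\mu$-space.
   Context: A point $x\in X$ is isolated if $\{x\}$ is clopen in $X$; $\dot X$ is the set of isolated points of $X$ and $X'=X\setminus\dot X$. $X/X'=(X\setminus X')\cup\{X'\}$ is the quotient space of $X$ obtained by collapsing $X'$ to the single point $\{X'\}$. $C_k(X,Y)$ is the space of continuous functions $X\to Y$ with the compact-open topology (subbase: $\{f:f(K)\subset U\}$, $K\subset X$ compact, $U\subset Y$ open), and $C_k'(X,Y)=\{f\in C_k(X,Y):f(X')\subset\{*_Y\}\}$ with the subspace topology. The point $\{X'\}$ is regarded as the unique non-isolated point of $X/X'$, so $C_k'(X/X',Y)=\{f\in C_k(X/X',Y): f(\{X'\})=*_Y\}$, i.e. $f$ takes the value $*_Y$ at the point $\{X'\}$. A map $q:X\to Q$ is compact-covering if each compact set $K\subset Q$ is contained in $q(C)$ for some compact set $C\subset X$. A subset $B\subset X$ is bounded if $f(B)$ is bounded in $\mathbb R$ for every continuous $f:X\to\mathbb R$; $X$ is a $\mu$-space if each closed bounded subset of $X$ is compact. $X$ is a $\dot\mu$-space if for any subset $A\subset\dot X$ the following are equivalent: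 (i) $A$ is contained in a compact subset of $X$; (ii) for any closed subset $D$ of $X$ with $D\subset\dot X$ the intersection $A\cap D$ is finite. *)

theory Defs
  imports "HOL-Analysis.Analysis"
begin

text \<open>No separation axioms are assumed, so "isolated" asks for \<open>{x}\<close> to be clopen, not
  merely open; hence \<open>nonisolated_points X\<close> is in general larger than
  \<open>X derived_set_of topspace X\<close>.\<close>

definition isolated_points :: "'a topology \<Rightarrow> 'a set" where
  "isolated_points X = {x \<in> topspace X. openin X {x} \<and> closedin X {x}}"

definition nonisolated_points :: "'a topology \<Rightarrow> 'a set" where
  "nonisolated_points X = topspace X - isolated_points X"

text \<open>The points of \<open>X/A\<close> are the classes of the collapsing relation: the point \<open>x \<notin> A\<close> of
  \<open>X/A = (X - A) \<union> {A}\<close> is represented by \<open>{x}\<close>, and \<open>A\<close> represents itself.\<close>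

definition collapse_map :: "'a set \<Rightarrow> 'a \<Rightarrow> 'a set" where
  "collapse_map A x = (if x \<in> A then A else {x})"

definition collapse_topology :: "'a topology \<Rightarrow> 'a set \<Rightarrow> 'a set topology" where
  "collapse_topology X A =
     topology (\<lambda>V. V \<subseteq> collapse_map A ` topspace X \<and>
                   openin X {x \<in> topspace X. collapse_map A x \<in> V})"

lemma openin_collapse_topology:
  "openin (collapse_topology X A) V \<longleftrightarrow>
     V \<subseteq> collapse_map A ` topspace X \<and> openin X {x \<in> topspace X. collapse_map A x \<in> V}"
proof -
  let ?L = "\<lambda>V. V \<subseteq> collapse_map A ` topspace X \<and>
                openin X {x \<in> topspace X. collapse_map A x \<in> V}"
  have "?L (S \<inter> T)" if "?L S" "?L T" for S T
  proof -
    have "{x \<in> topspace X. collapse_map A x \<in> S \<inter> T} =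
        {x \<in> topspace X. collapse_map A x \<in> S} \<inter> {x \<in> topspace X. collapse_map A x \<in> T}"
      by auto
    then show ?thesis using that by auto
  qed
  moreover have "?L (\<Union>\<K>)" if "\<forall>K\<in>\<K>. ?L K" for \<K>
  proof -
    have "{x \<in> topspace X. collapse_map A x \<in> \<Union>\<K>} =
        (\<Union>K\<in>\<K>. {x \<in> topspace X. collapse_map A x \<in> K})"
      by auto
    moreover have "openin X \<dots>" using that by (intro openin_Union) auto
    ultimately show ?thesis using that by auto
  qed
  ultimately have "istopology ?L"
    unfolding istopology_def by blast
  then show ?thesis
    unfolding collapse_topology_def by (simp add: topology_inverse')
qed

lemma topspace_collapse_topology:
  "topspace (collapse_topology X A) = collapse_map A ` topspace X"
proof -
  have "{x \<in> topspace X. collapse_map A x \<in> collapse_map A ` topspace X} = topspace X"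
    by auto
  then have "openin (collapse_topology X A) (collapse_map A ` topspace X)"
    by (simp add: openin_collapse_topology)
  then show ?thesis
    by (meson openin_collapse_topology openin_subset openin_topspace subset_antisym)
qed

lemma quotient_map_collapse:
  "quotient_map X (collapse_topology X A) (collapse_map A)"
  unfolding quotient_map_def topspace_collapse_topology openin_collapse_topology by auto

text \<open>Continuous maps on \<open>topspace X\<close> are represented by their extensional representatives, so
  that equality in the function space is equality on \<open>topspace X\<close>.\<close>

definition continuous_maps :: "'a topology \<Rightarrow> 'b topology \<Rightarrow> ('a \<Rightarrow> 'b) set" where
  "continuous_maps X Y = {f \<in> extensional (topspace X). continuous_map X Y f}"

definition compact_open_topology :: "'a topology \<Rightarrow> 'b topology \<Rightarrow> ('a \<Rightarrow> 'b) topology" where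
  "compact_open_topology X Y =
     topology_generated_by
       {{f \<in> continuous_maps X Y. f ` K \<subseteq> U} | K U. compactin X K \<and> openin Y U}"

lemma topspace_compact_open_topology:
  "topspace (compact_open_topology X Y) = continuous_maps X Y"
proof -
  have "\<exists>K U. continuous_maps X Y = {f \<in> continuous_maps X Y. f ` K \<subseteq> U} \<and>
      compactin X K \<and> openin Y U"
    by (intro exI[of _ "{}"]) auto
  then show ?thesis
    unfolding compact_open_topology_def topology_generated_by_topspace by blast
qed

text \<open>\<open>C\<^sub>k'(X,Y)\<close> is the case \<open>A = nonisolated_points X\<close>. For the quotient
  \<open>X/X'\<close> one takes \<open>A = {X'}\<close>: the collapsed point counts as non-isolated even when it
  happens to be isolated in the quotient topology (e.g. for \<open>X\<close> without isolated points).\<close>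

definition pointed_compact_open_topology ::
    "'a topology \<Rightarrow> 'a set \<Rightarrow> 'b topology \<Rightarrow> 'b \<Rightarrow> ('a \<Rightarrow> 'b) topology" where
  "pointed_compact_open_topology X A Y y0 =
     subtopology (compact_open_topology X Y) {f. f ` A \<subseteq> {y0}}"

definition pullback_map :: "'a topology \<Rightarrow> ('a \<Rightarrow> 'c) \<Rightarrow> ('c \<Rightarrow> 'b) \<Rightarrow> 'a \<Rightarrow> 'b" where
  "pullback_map X q f = restrict (f \<circ> q) (topspace X)"

definition compact_covering_map :: "'a topology \<Rightarrow> 'b topology \<Rightarrow> ('a \<Rightarrow> 'b) \<Rightarrow> bool" where
  "compact_covering_map X Q q \<longleftrightarrow>
     q \<in> topspace X \<rightarrow> topspace Q \<and>
     (\<forall>K. compactin Q K \<longrightarrow> (\<exists>C. compactin X C \<and> K \<subseteq> q ` C))"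

definition functionally_bounded_in :: "'a topology \<Rightarrow> 'a set \<Rightarrow> bool" where
  "functionally_bounded_in X B \<longleftrightarrow>
     B \<subseteq> topspace X \<and> (\<forall>f. continuous_map X euclideanreal f \<longrightarrow> bounded (f ` B))"

definition mu_space :: "'a topology \<Rightarrow> bool" where
  "mu_space X \<longleftrightarrow>
     (\<forall>B. closedin X B \<and> functionally_bounded_in X B \<longrightarrow> compactin X B)"

definition dot_mu_space :: "'a topology \<Rightarrow> bool" where
  "dot_mu_space X \<longleftrightarrow>
     (\<forall>A \<subseteq> isolated_points X.
        (\<exists>C. compactin X C \<and> A \<subseteq> C) \<longleftrightarrow>
        (\<forall>D. closedin X D \<and> D \<subseteq> isolated_points X \<longrightarrow> finite (A \<inter> D)))"

end

theory Submission
  imports Defs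
begin

text \<open>The neighbourhoods of the point \<open>X'\<close> in \<open>X/X'\<close> are the complements of the (images of)
  closed sets \<open>D \<subseteq> isolated_points X\<close>, and all other points are clopen. So the compact sets
  containing \<open>X'\<close> are exactly those meeting every such \<open>D\<close> in a finite set, which is condition
  (ii) of a \<open>dot_mu_space\<close>; this makes (1) and (2) equivalent. If \<open>q\<close> is compact-covering then
  each compact set of \<open>X/X'\<close> is even the image of a compact set, because its preimage
  is closed or finite; hence \<open>q\<^sup>*\<close> is a homeomorphism. Conversely, a neighbourhood of the
  constant map \<open>y0\<close> restricts functions only on a compact set, so openness of \<open>q\<^sup>*\<close>, tested on
  functions that differ from \<open>y0\<close> at a single isolated point, yields compact coverings.
  In a \<open>mu_space\<close>, a function unbounded on \<open>A\<close> would produce an infinite closed discrete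
  subset of \<open>A\<close>, so \<open>A\<close> satisfying (ii) has functionally bounded, hence compact, closure.\<close>

section \<open>Isolated points and the finiteness of compact sets of them\<close>

abbreviation isolated_collapse :: "'a topology \<Rightarrow> 'a \<Rightarrow> 'a set" where
  "isolated_collapse X \<equiv> collapse_map (nonisolated_points X)"

abbreviation isolated_quotient :: "'a topology \<Rightarrow> 'a set topology" where
  "isolated_quotient X \<equiv> collapse_topology X (nonisolated_points X)"

lemma isolated_points_subset_topspace: "isolated_points X \<subseteq> topspace X"
  by (auto simp: isolated_points_def)

lemma openin_subset_isolated_points:
  assumes "A \<subseteq> isolated_points X"
  shows "openin X A"
proof -
  have "A = (\<Union>x\<in>A. {x})" by auto
  also have "openin X \<dots>"
    using assms by (intro openin_Union) (auto simp: isolated_points_def)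
  finally show ?thesis .
qed

text \<open>The complement consists of isolated points and so is open. Hence the preimage of any set
  of classes containing the collapsed point is closed.\<close>

lemma closedin_superset_nonisolated_points:
  assumes "nonisolated_points X \<subseteq> B" "B \<subseteq> topspace X"
  shows "closedin X B"
proof -
  have "openin X (topspace X - B)"
    by (rule openin_subset_isolated_points) (use assms in \<open>auto simp: nonisolated_points_def\<close>)
  then show ?thesis
    using assms(2) by (simp add: closedin_def)
qed

text \<open>Non-discreteness enters here: it makes \<open>X'\<close> an actual point of the
  quotient.\<close>

lemma nonisolated_points_nonempty:
  assumes "X \<noteq> discrete_topology (topspace X)"
  shows "nonisolated_points X \<noteq> {}"
proof
  assume "nonisolated_points X = {}"
  then have "isolated_points X = topspace X"
    using isolated_points_subset_topspace[of X] by (auto simp: nonisolated_points_def)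
  then have "discrete_topology (topspace X) = X"
    using openin_subset_isolated_points[of _ X] by (auto simp: discrete_topology_unique)
  with assms show False by simp
qed

text \<open>The open singletons cover \<open>K\<close>, and a finite subcover has finitely many
  points.\<close>

lemma compactin_open_points_imp_finite:
  assumes "compactin X K" "\<And>x. x \<in> K \<Longrightarrow> openin X {x}"
  shows "finite K"
proof -
  have "\<exists>\<F>. finite \<F> \<and> \<F> \<subseteq> (\<lambda>x. {x}) ` K \<and> K \<subseteq> \<Union>\<F>"
    by (rule compactinD[OF assms(1)]) (use assms(2) in auto)
  then obtain \<F> where \<F>: "finite \<F>" "\<F> \<subseteq> (\<lambda>x. {x}) ` K" "K \<subseteq> \<Union>\<F>" by blast
  have "finite (\<Union>\<F>)"
    using \<F>(1,2) by (intro finite_Union) auto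
  then show ?thesis
    using \<F>(3) by (rule rev_finite_subset)
qed

text \<open>A compact set cuts a closed set of isolated points in a compact set whose points are
  open. This gives (i) implies (ii) of \<open>dot_mu_space\<close> in every space.\<close>

lemma compactin_Int_closed_isolated_finite:
  assumes "compactin X C" "closedin X D" "D \<subseteq> isolated_points X"
  shows "finite (C \<inter> D)"
proof (rule compactin_open_points_imp_finite)
  show "compactin X (C \<inter> D)"
    using assms(1,2) by (rule compact_Int_closedin)
  show "openin X {x}" if "x \<in> C \<inter> D" for x
    using that assms(3) by (auto simp: isolated_points_def)
qed

lemma subset_compactin_Int_closed_isolated_finite:
  assumes "compactin X C" "A \<subseteq> C" "closedin X D" "D \<subseteq> isolated_points X"
  shows "finite (A \<inter> D)"
  using compactin_Int_closed_isolated_finite[OF assms(1,3,4)]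
  by (rule rev_finite_subset) (use assms(2) in blast)

section \<open>Points, open sets and compact sets of the quotient \<open>X/X'\<close>\<close>

lemma isolated_collapse_isolated [simp]:
  "x \<in> isolated_points X \<Longrightarrow> isolated_collapse X x = {x}"
  by (simp add: collapse_map_def nonisolated_points_def)

lemma isolated_collapse_nonisolated [simp]:
  "x \<in> nonisolated_points X \<Longrightarrow> isolated_collapse X x = nonisolated_points X"
  by (simp add: collapse_map_def)

text \<open>If \<open>X'\<close> were empty, the right-hand side would contain the empty set, which
  is not a class.\<close>

lemma topspace_isolated_quotient:
  assumes "nonisolated_points X \<noteq> {}"
  shows "topspace (isolated_quotient X) =
    insert (nonisolated_points X) ((\<lambda>x. {x}) ` isolated_points X)"
proof -
  have "topspace X = nonisolated_points X \<union> isolated_points X"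
    using isolated_points_subset_topspace[of X] by (auto simp: nonisolated_points_def)
  moreover have "isolated_collapse X ` nonisolated_points X = {nonisolated_points X}"
    using assms by auto
  moreover have "isolated_collapse X ` isolated_points X = (\<lambda>x. {x}) ` isolated_points X"
    by (intro image_cong) auto
  ultimately show ?thesis
    by (simp add: topspace_collapse_topology image_Un)
qed

lemma singleton_neq_nonisolated_points:
  "x \<in> isolated_points X \<Longrightarrow> {x} \<noteq> nonisolated_points X"
  by (auto simp: nonisolated_points_def)

text \<open>The preimage under the collapse is \<open>A\<close> itself, a union of open
  singletons.\<close>

lemma openin_isolated_quotient_isolated:
  assumes "A \<subseteq> isolated_points X"
  shows "openin (isolated_quotient X) ((\<lambda>x. {x}) ` A)"
proof -
  have "{x \<in> topspace X. isolated_collapse X x \<in> (\<lambda>x. {x}) ` A} = A"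
    using assms by (auto simp: collapse_map_def nonisolated_points_def isolated_points_def)
  moreover have "(\<lambda>x. {x}) ` A = isolated_collapse X ` A"
    using assms by (intro image_cong) auto
  ultimately show ?thesis
    using assms isolated_points_subset_topspace[of X] openin_subset_isolated_points[OF assms]
    by (auto simp: openin_collapse_topology)
qed

text \<open>Every point of the quotient other than the collapsed one is open.\<close>

lemma compactin_isolated_quotient_finite:
  assumes "nonisolated_points X \<noteq> {}" "compactin (isolated_quotient X) K"
    and "nonisolated_points X \<notin> K"
  shows "finite K"
proof (rule compactin_open_points_imp_finite[OF assms(2)])
  fix c assume "c \<in> K"
  then obtain x where "x \<in> isolated_points X" "c = {x}"
    using compactin_subset_topspace[OF assms(2)] assms(3)
    unfolding topspace_isolated_quotient[OF assms(1)] by blast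
  then show "openin (isolated_quotient X) {c}"
    using openin_isolated_quotient_isolated[of "{x}"] by simp
qed

text \<open>The right-hand side is condition (ii) for \<open>A\<close>. It says that every
  neighbourhood of the collapsed point contains all but finitely many of the classes from
  \<open>A\<close>.\<close>

lemma compactin_isolated_quotient_iff:
  assumes "nonisolated_points X \<noteq> {}" "A \<subseteq> isolated_points X"
  shows "compactin (isolated_quotient X) (insert (nonisolated_points X) ((\<lambda>x. {x}) ` A)) \<longleftrightarrow>
    (\<forall>D. closedin X D \<and> D \<subseteq> isolated_points X \<longrightarrow> finite (A \<inter> D))"
    (is "compactin ?Q ?K \<longleftrightarrow> ?R")
proof
  assume K: "compactin ?Q ?K"
  show ?R
  proof (intro allI impI, elim conjE)
    fix D assume D: "closedin X D" "D \<subseteq> isolated_points X"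
    \<comment> \<open>\<open>D\<close> is the full preimage of its image, so the quotient property
      makes that image closed. It cuts the compact set in a compact set that misses the collapsed
      point, hence in a finite one.\<close>
    have "{x \<in> topspace X. isolated_collapse X x \<in> (\<lambda>x. {x}) ` D} = D"
      using D by (auto simp: collapse_map_def nonisolated_points_def isolated_points_def)
    moreover have "(\<lambda>x. {x}) ` D \<subseteq> topspace ?Q"
      using D(2) unfolding topspace_isolated_quotient[OF assms(1)] by blast
    ultimately have "closedin ?Q ((\<lambda>x. {x}) ` D)"
      using D(1) quotient_map_collapse[of X "nonisolated_points X"]
      unfolding quotient_map_closedin by metis
    then have "compactin ?Q (?K \<inter> (\<lambda>x. {x}) ` D)"
      using K by (simp add: compact_Int_closedin)
    then have "finite (?K \<inter> (\<lambda>x. {x}) ` D)"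
      by (rule compactin_isolated_quotient_finite[OF assms(1)])
        (use D(2) singleton_neq_nonisolated_points[of _ X] in auto)
    then have "finite ((\<lambda>x. {x}) ` (A \<inter> D))"
      by (rule rev_finite_subset) auto
    then show "finite (A \<inter> D)"
      by (rule finite_imageD) auto
  qed
next
  assume R: ?R
  show "compactin ?Q ?K"
    unfolding compactin_def
  proof (intro conjI allI impI)
    show "?K \<subseteq> topspace ?Q"
      using assms(2) unfolding topspace_isolated_quotient[OF assms(1)]
      by (intro insert_mono image_mono)
    fix \<U> assume \<U>: "(\<forall>U\<in>\<U>. openin ?Q U) \<and> ?K \<subseteq> \<Union>\<U>"
    \<comment> \<open>One member of the cover contains the collapsed point; only the classes outside
      it remain to be covered.\<close>
    then obtain W where W: "W \<in> \<U>" "nonisolated_points X \<in> W" by auto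
    \<comment> \<open>The part of \<open>X\<close> whose classes \<open>W\<close> misses: closed
      because \<open>W\<close> is open, and made of isolated points because \<open>W\<close>
      contains the class \<open>X'\<close>.\<close>
    define D where "D = topspace X - {x \<in> topspace X. isolated_collapse X x \<in> W}"
    have "closedin X D"
      using W \<U> unfolding D_def openin_collapse_topology by blast
    moreover have "D \<subseteq> isolated_points X"
      using W(2) unfolding D_def
      by (auto simp: nonisolated_points_def collapse_map_def split: if_splits)
    ultimately have fin: "finite (A \<inter> D)" using R by blast
    have "\<forall>x\<in>A \<inter> D. \<exists>V\<in>\<U>. {x} \<in> V" using \<U> by auto
    then obtain V where V: "\<And>x. x \<in> A \<inter> D \<Longrightarrow> V x \<in> \<U> \<and> {x} \<in> V x" by metis
    have "{x} \<in> W" if "x \<in> A" "x \<notin> D" for x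
    proof -
      have x: "x \<in> isolated_points X" using that assms(2) by blast
      then have "isolated_collapse X x \<in> W"
        using that isolated_points_subset_topspace[of X] unfolding D_def by blast
      then show ?thesis using x by simp
    qed
    then have "?K \<subseteq> \<Union>(insert W (V ` (A \<inter> D)))"
      using W(2) V by auto
    then show "\<exists>\<F>. finite \<F> \<and> \<F> \<subseteq> \<U> \<and> ?K \<subseteq> \<Union>\<F>"
      using fin W V by (intro exI[of _ "insert W (V ` (A \<inter> D))"]) auto
  qed
qed

text \<open>The fibre over \<open>{x}\<close> with \<open>x\<close> isolated is just
  \<open>x\<close>: a point of \<open>X'\<close> goes to \<open>X'\<close>, which differs from
  \<open>{x}\<close>. So a set whose image covers these classes contains \<open>A\<close>
  itself.\<close>

lemma isolated_collapse_preimage_singletons: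
  assumes "A \<subseteq> isolated_points X" "(\<lambda>x. {x}) ` A \<subseteq> isolated_collapse X ` C" "C \<subseteq> topspace X"
  shows "A \<subseteq> C"
proof
  fix x assume "x \<in> A"
  then obtain z where z: "z \<in> C" "isolated_collapse X z = {x}" using assms(2) by force
  have "z \<notin> nonisolated_points X"
    using z(2) \<open>x \<in> A\<close> assms(1) singleton_neq_nonisolated_points[of x X] by auto
  then show "x \<in> C" using z by (simp add: collapse_map_def)
qed

section \<open>Equivalence of (1) and (2)\<close>

lemma isolated_collapse_in_topspace:
  "isolated_collapse X \<in> topspace X \<rightarrow> topspace (isolated_quotient X)"
  by (simp add: topspace_collapse_topology)

lemma compactin_insert:
  assumes "compactin X K" "x \<in> topspace X"
  shows "compactin X (insert x K)"
  using compactin_Un[of X "{x}" K] assms by simp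

text \<open>Adjoining the collapsed point brings any set of classes into the form treated by
  \<open>compactin_isolated_quotient_iff\<close>.\<close>

lemma subset_isolated_quotient_eq:
  assumes "nonisolated_points X \<noteq> {}" "K \<subseteq> topspace (isolated_quotient X)"
  shows "insert (nonisolated_points X) K =
    insert (nonisolated_points X) ((\<lambda>x. {x}) ` {x \<in> isolated_points X. {x} \<in> K})"
  using assms(2) unfolding topspace_isolated_quotient[OF assms(1)] by auto

text \<open>Condition (ii) for \<open>A\<close> means that the classes of \<open>A\<close> with the
  collapsed point form a compact set, and (i) means that a compact set of \<open>X\<close> maps onto
  a set containing them. Passing from (ii) to (i) is thus the covering of that compact set.\<close>

lemma dot_mu_space_iff_compact_covering:
  assumes ne: "nonisolated_points X \<noteq> {}"
  shows "dot_mu_space X \<longleftrightarrow> compact_covering_map X (isolated_quotient X) (isolated_collapse X)"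
    (is "?L \<longleftrightarrow> ?R")
proof
  let ?Q = "isolated_quotient X"
  assume L: ?L
  show ?R
    unfolding compact_covering_map_def
  proof (intro conjI allI impI isolated_collapse_in_topspace)
    fix K assume K: "compactin ?Q K"
    define A where "A = {x \<in> isolated_points X. {x} \<in> K}"
    have A: "A \<subseteq> isolated_points X" by (auto simp: A_def)
    have eq: "insert (nonisolated_points X) K = insert (nonisolated_points X) ((\<lambda>x. {x}) ` A)"
      unfolding A_def by (rule subset_isolated_quotient_eq[OF ne compactin_subset_topspace[OF K]])
    have "compactin ?Q (insert (nonisolated_points X) K)"
      by (rule compactin_insert[OF K]) (simp add: topspace_isolated_quotient[OF ne])
    then have "\<forall>D. closedin X D \<and> D \<subseteq> isolated_points X \<longrightarrow> finite (A \<inter> D)"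
      unfolding eq compactin_isolated_quotient_iff[OF ne A] .
    then obtain C where C: "compactin X C" "A \<subseteq> C"
      using L A unfolding dot_mu_space_def by blast
    \<comment> \<open>\<open>C\<close> may miss \<open>X'\<close>; adding one point of
      \<open>X'\<close> puts the collapsed point into the image.\<close>
    obtain p where p: "p \<in> nonisolated_points X" using ne by blast
    have "compactin X (insert p C)"
      using C(1) p by (intro compactin_insert) (auto simp: nonisolated_points_def)
    moreover have "(\<lambda>x. {x}) ` A = isolated_collapse X ` A"
      using A by (intro image_cong) auto
    then have "K \<subseteq> insert (nonisolated_points X) (isolated_collapse X ` A)"
      using subset_insertI[of K "nonisolated_points X"] unfolding eq by simp
    then have "K \<subseteq> isolated_collapse X ` insert p C"
      using image_mono[OF C(2), of "isolated_collapse X"]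
      by (simp only: image_insert isolated_collapse_nonisolated[OF p]) blast
    ultimately show "\<exists>C. compactin X C \<and> K \<subseteq> isolated_collapse X ` C" by blast
  qed
next
  assume R: ?R
  show ?L
    unfolding dot_mu_space_def
  proof (intro allI impI iffI)
    fix A D assume "\<exists>C. compactin X C \<and> A \<subseteq> C" and "closedin X D \<and> D \<subseteq> isolated_points X"
    then show "finite (A \<inter> D)"
      using subset_compactin_Int_closed_isolated_finite by metis
  next
    fix A
    assume A: "A \<subseteq> isolated_points X"
      and "\<forall>D. closedin X D \<and> D \<subseteq> isolated_points X \<longrightarrow> finite (A \<inter> D)"
    then have "compactin (isolated_quotient X) (insert (nonisolated_points X) ((\<lambda>x. {x}) ` A))"
      using compactin_isolated_quotient_iff[OF ne A] by blast
    then obtain C where C: "compactin X C"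
      "insert (nonisolated_points X) ((\<lambda>x. {x}) ` A) \<subseteq> isolated_collapse X ` C"
      using R unfolding compact_covering_map_def by meson
    then have "A \<subseteq> C"
      using isolated_collapse_preimage_singletons[OF A _ compactin_subset_topspace[OF C(1)]]
      by simp
    then show "\<exists>C. compactin X C \<and> A \<subseteq> C"
      using C(1) by blast
  qed
qed

text \<open>Equality instead of inclusion is what continuity of the inverse of the pullback
  requires. If \<open>K\<close> contains the collapsed point, its preimage is closed and cuts the
  covering compact set in a compact one; otherwise \<open>K\<close> is finite and finitely many
  preimages suffice.\<close>

lemma compact_covering_imp_compact_image:
  assumes ne: "nonisolated_points X \<noteq> {}"
    and cov: "compact_covering_map X (isolated_quotient X) (isolated_collapse X)"
    and K: "compactin (isolated_quotient X) K"
  obtains C where "compactin X C" "isolated_collapse X ` C = K"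
proof (cases "nonisolated_points X \<in> K")
  case True
  define B where "B = {x \<in> topspace X. isolated_collapse X x \<in> K}"
  have "closedin X B"
  proof (rule closedin_superset_nonisolated_points)
    show "nonisolated_points X \<subseteq> B"
      using True by (auto simp: B_def nonisolated_points_def collapse_map_def)
  qed (auto simp: B_def)
  moreover obtain C where C: "compactin X C" "K \<subseteq> isolated_collapse X ` C"
    using cov K unfolding compact_covering_map_def by blast
  ultimately have "compactin X (B \<inter> C)"
    by (simp add: closed_Int_compactin)
  moreover have "isolated_collapse X ` (B \<inter> C) = K"
    using C compactin_subset_topspace[OF C(1)] unfolding B_def by blast
  ultimately show thesis by (rule that)
next
  case False
  have "K \<subseteq> isolated_collapse X ` topspace X"
    using compactin_subset_topspace[OF K] by (simp add: topspace_collapse_topology)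
  then obtain C where C: "C \<subseteq> topspace X" "finite C" "isolated_collapse X ` C = K"
    using finite_subset_image[OF compactin_isolated_quotient_finite[OF ne K False]] by metis
  then show thesis
    using that finite_imp_compactin by blast
qed

section \<open>The pointed compact-open topology and pullback along a quotient map\<close>

lemma topspace_pointed_compact_open_topology:
  "topspace (pointed_compact_open_topology X A Y y0) =
    {f \<in> continuous_maps X Y. f ` A \<subseteq> {y0}}"
  by (auto simp: pointed_compact_open_topology_def topspace_compact_open_topology)

lemma openin_pointed_compact_open_topology:
  assumes "compactin X K" "openin Y U"
  shows "openin (pointed_compact_open_topology X A Y y0)
    {f \<in> continuous_maps X Y. f ` A \<subseteq> {y0} \<and> f ` K \<subseteq> U}"
proof -
  have "openin (compact_open_topology X Y) {f \<in> continuous_maps X Y. f ` K \<subseteq> U}"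
    unfolding compact_open_topology_def using assms by (intro topology_generated_by_Basis) blast
  then have "openin (pointed_compact_open_topology X A Y y0)
      ({f \<in> continuous_maps X Y. f ` K \<subseteq> U} \<inter> {f. f ` A \<subseteq> {y0}})"
    unfolding pointed_compact_open_topology_def by (rule openin_subtopology_Int)
  then show ?thesis
    by (simp add: Int_def conj_ac)
qed

text \<open>Continuity into a generated topology is decided on the generating sets.\<close>

lemma continuous_map_into_pointed_compact_open_topology:
  assumes "\<And>t. t \<in> topspace T \<Longrightarrow> h t \<in> continuous_maps X Y \<and> h t ` A \<subseteq> {y0}"
    and "\<And>K U. compactin X K \<Longrightarrow> openin Y U \<Longrightarrow> openin T {t \<in> topspace T. h t ` K \<subseteq> U}"
  shows "continuous_map T (pointed_compact_open_topology X A Y y0) h"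
  unfolding pointed_compact_open_topology_def continuous_map_in_subtopology
proof
  show "h \<in> topspace T \<rightarrow> {f. f ` A \<subseteq> {y0}}"
    using assms(1) by blast
  show "continuous_map T (compact_open_topology X Y) h"
    unfolding compact_open_topology_def
  proof (rule continuous_on_generated_topo)
    fix W assume "W \<in> {{f \<in> continuous_maps X Y. f ` K \<subseteq> U} | K U. compactin X K \<and> openin Y U}"
    then obtain K U where KU: "compactin X K" "openin Y U"
      and W: "W = {f \<in> continuous_maps X Y. f ` K \<subseteq> U}" by blast
    have "h -` W \<inter> topspace T = {t \<in> topspace T. h t ` K \<subseteq> U}"
      using assms(1) by (auto simp: W)
    then show "openin T (h -` W \<inter> topspace T)"
      using assms(2)[OF KU] by simp
  next
    show "h ` topspace T \<subseteq> \<Union>{{f \<in> continuous_maps X Y. f ` K \<subseteq> U} | K U. compactin X K \<and> openin Y U}"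
      using assms(1) topspace_compact_open_topology[of X Y]
      unfolding compact_open_topology_def topology_generated_by_topspace by blast
  qed
qed

lemma pullback_map_apply: "x \<in> topspace X \<Longrightarrow> pullback_map X q f x = f (q x)"
  by (simp add: pullback_map_def)

lemma pullback_map_image:
  "K \<subseteq> topspace X \<Longrightarrow> pullback_map X q f ` K = f ` q ` K"
  unfolding image_image by (intro image_cong) (auto simp: pullback_map_apply)

lemma pullback_map_in_continuous_maps:
  assumes "continuous_map X Q q" "f \<in> continuous_maps Q Y"
  shows "pullback_map X q f \<in> continuous_maps X Y"
proof -
  have "continuous_map X Y (f \<circ> q)"
    using assms by (auto simp: continuous_maps_def intro: continuous_map_compose)
  then have "continuous_map X Y (pullback_map X q f)"
    by (rule continuous_map_eq) (simp add: pullback_map_apply)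
  then show ?thesis by (simp add: continuous_maps_def pullback_map_def)
qed

text \<open>By \<open>const\<close> every admissible map factors through \<open>q\<close>, and the
  factor is continuous because \<open>q\<close> is a quotient map. By \<open>lift\<close> each
  subbasic condition on a compact set of \<open>Q\<close> becomes one on a compact set of
  \<open>X\<close>, so the inverse is continuous.\<close>

lemma homeomorphic_map_pullback:
  fixes X :: "'a topology" and Q :: "'c topology" and Y :: "'b topology"
  assumes q: "quotient_map X Q q"
    and lift: "\<And>K. compactin Q K \<Longrightarrow> \<exists>C. compactin X C \<and> q ` C = K"
    and A: "A \<subseteq> topspace X"
    and const: "\<And>f x z. f \<in> continuous_maps X Y \<Longrightarrow> f ` A \<subseteq> {y0} \<Longrightarrow>
                  x \<in> topspace X \<Longrightarrow> z \<in> topspace X \<Longrightarrow> q x = q z \<Longrightarrow> f x = f z"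
  shows "homeomorphic_map (pointed_compact_open_topology Q (q ` A) Y y0)
           (pointed_compact_open_topology X A Y y0) (pullback_map X q)"
proof -
  let ?P = "pointed_compact_open_topology Q (q ` A) Y y0"
  let ?R = "pointed_compact_open_topology X A Y y0"
  \<comment> \<open>The inverse of the pullback: evaluate at a chosen point of the fibre. The
    restriction makes the result extensional, as membership in \<open>continuous_maps\<close>
    demands.\<close>
  define g :: "('a \<Rightarrow> 'b) \<Rightarrow> 'c \<Rightarrow> 'b" where
    "g = (\<lambda>f. restrict (\<lambda>c. f (inv_into (topspace X) q c)) (topspace Q))"
  have cont: "continuous_map X Q q"
    using q by (rule quotient_imp_continuous_map)
  have surj: "q ` topspace X = topspace Q"
    using q by (rule quotient_imp_surjective_map)
  have g_q: "g f (q x) = f x"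
    if "f \<in> continuous_maps X Y" "f ` A \<subseteq> {y0}" "x \<in> topspace X" for f x
  proof -
    \<comment> \<open>The chosen preimage of \<open>q x\<close> may differ from \<open>x\<close>,
      but \<open>const\<close> gives both the same value.\<close>
    have "q x \<in> q ` topspace X" using that(3) by blast
    then show ?thesis
      using that const[OF that(1,2), of "inv_into (topspace X) q (q x)" x] surj
      by (auto simp: g_def inv_into_into f_inv_into_f)
  qed
  have g_image: "g f ` q ` C = f ` C"
    if "f \<in> continuous_maps X Y" "f ` A \<subseteq> {y0}" "C \<subseteq> topspace X" for f C
    unfolding image_image using that by (intro image_cong) (auto simp: g_q)
  have g_cont: "g f \<in> continuous_maps Q Y" if f: "f \<in> continuous_maps X Y" "f ` A \<subseteq> {y0}" for f
  proof -
    have "continuous_map X Y f" using f by (simp add: continuous_maps_def)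
    then have "continuous_map X Y (g f \<circ> q)"
      by (rule continuous_map_eq) (simp add: g_q f)
    then have "continuous_map Q Y (g f)"
      by (rule continuous_compose_quotient_map[OF q])
    then show ?thesis by (simp add: continuous_maps_def g_def)
  qed
  have "continuous_map ?P ?R (pullback_map X q)"
  proof (rule continuous_map_into_pointed_compact_open_topology)
    fix f assume "f \<in> topspace ?P"
    then show "pullback_map X q f \<in> continuous_maps X Y \<and> pullback_map X q f ` A \<subseteq> {y0}"
      using pullback_map_in_continuous_maps[OF cont, of f Y] pullback_map_image[OF A, of q f]
      by (simp add: topspace_pointed_compact_open_topology)
  next
    fix K U assume K: "compactin X K" and U: "openin Y U"
    have "{f \<in> topspace ?P. pullback_map X q f ` K \<subseteq> U} =
        {f \<in> continuous_maps Q Y. f ` q ` A \<subseteq> {y0} \<and> f ` q ` K \<subseteq> U}"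
      by (simp add: topspace_pointed_compact_open_topology conj_assoc
          pullback_map_image[OF compactin_subset_topspace[OF K]])
    then show "openin ?P {f \<in> topspace ?P. pullback_map X q f ` K \<subseteq> U}"
      using openin_pointed_compact_open_topology[OF image_compactin[OF K cont] U, of "q ` A" y0]
      by (simp only:)
  qed
  moreover have "continuous_map ?R ?P g"
  proof (rule continuous_map_into_pointed_compact_open_topology)
    fix f assume "f \<in> topspace ?R"
    then show "g f \<in> continuous_maps Q Y \<and> g f ` q ` A \<subseteq> {y0}"
      using g_cont g_image[OF _ _ A] by (simp add: topspace_pointed_compact_open_topology)
  next
    fix K U assume K: "compactin Q K" and U: "openin Y U"
    obtain C where C: "compactin X C" "q ` C = K" using lift[OF K] by blast
    \<comment> \<open>Since \<open>q\<close> maps \<open>C\<close> onto exactly \<open>K\<close>,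
      the values of \<open>g f\<close> on \<open>K\<close> are those of \<open>f\<close> on
      \<open>C\<close>.\<close>
    have "{f \<in> topspace ?R. g f ` K \<subseteq> U} =
        {f \<in> continuous_maps X Y. f ` A \<subseteq> {y0} \<and> f ` C \<subseteq> U}"
      by (simp add: topspace_pointed_compact_open_topology C(2)[symmetric] conj_assoc
          g_image[OF _ _ compactin_subset_topspace[OF C(1)]] cong: conj_cong)
    then show "openin ?R {f \<in> topspace ?R. g f ` K \<subseteq> U}"
      using openin_pointed_compact_open_topology[OF C(1) U, of A y0] by (simp only:)
  qed
  moreover have "g (pullback_map X q f) = f" if "f \<in> topspace ?P" for f
  proof -
    have f: "f \<in> continuous_maps Q Y" "f ` q ` A \<subseteq> {y0}"
      using that by (auto simp: topspace_pointed_compact_open_topology)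
    have "f \<in> extensional (topspace Q)" "g (pullback_map X q f) \<in> extensional (topspace Q)"
      using f by (simp_all add: continuous_maps_def g_def)
    moreover have "g (pullback_map X q f) c = f c" if c: "c \<in> topspace Q" for c
    proof -
      obtain x where "x \<in> topspace X" "c = q x" using c surj by auto
      then show ?thesis
        using g_q[of "pullback_map X q f"] pullback_map_in_continuous_maps[OF cont f(1)]
          pullback_map_image[OF A, of q f] f(2) by (simp add: pullback_map_apply)
    qed
    ultimately show ?thesis by (metis extensionalityI)
  qed
  moreover have "pullback_map X q (g f) = f" if "f \<in> topspace ?R" for f
  proof -
    have f: "f \<in> continuous_maps X Y" "f ` A \<subseteq> {y0}"
      using that by (auto simp: topspace_pointed_compact_open_topology)
    show ?thesis
      by (rule extensionalityI[of _ "topspace X"])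
        (use f in \<open>auto simp: continuous_maps_def pullback_map_def g_q\<close>)
  qed
  ultimately have "homeomorphic_maps ?P ?R (pullback_map X q) g"
    by (simp add: homeomorphic_maps_def)
  then show ?thesis
    using homeomorphic_map_maps by blast
qed

section \<open>From the homeomorphism back to compact coverings\<close>

lemma compact_open_neighbourhood_of_constant:
  assumes "openin (compact_open_topology X Y) W" "restrict (\<lambda>_. y) (topspace X) \<in> W"
  obtains C where "compactin X C"
    "\<And>f. f \<in> continuous_maps X Y \<Longrightarrow> f ` C \<subseteq> {y} \<Longrightarrow> f \<in> W"
proof -
  have "generate_topology_on
      {{f \<in> continuous_maps X Y. f ` K \<subseteq> U} | K U. compactin X K \<and> openin Y U} W"
    using assms(1) unfolding compact_open_topology_def by (rule openin_topology_generated_by)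
  \<comment> \<open>Induction on the generation of \<open>W\<close>: an intersection takes the union
    of the two compact sets, and a union keeps that of a member containing the constant map.\<close>
  then have "\<exists>C. compactin X C \<and> (\<forall>f \<in> continuous_maps X Y. f ` C \<subseteq> {y} \<longrightarrow> f \<in> W)"
    using assms(2)
  proof induction
    case (Int a b)
    then obtain C D where "compactin X C" "\<forall>f \<in> continuous_maps X Y. f ` C \<subseteq> {y} \<longrightarrow> f \<in> a"
      and "compactin X D" "\<forall>f \<in> continuous_maps X Y. f ` D \<subseteq> {y} \<longrightarrow> f \<in> b" by blast
    then show ?case
      by (intro exI[of _ "C \<union> D"]) (auto simp: compactin_Un image_Un)
  next
    case (UN \<K>)
    then obtain k where "k \<in> \<K>" "restrict (\<lambda>_. y) (topspace X) \<in> k" by blast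
    then show ?case using UN.IH[of k] by blast
  next
    case (Basis s)
    then obtain K U where K: "compactin X K" and s: "s = {f \<in> continuous_maps X Y. f ` K \<subseteq> U}"
      by blast
    \<comment> \<open>The constant map lies in the subbasic set, so \<open>y\<close> is in
      \<open>U\<close> unless \<open>K\<close> is empty; either way \<open>K\<close> itself serves
      as \<open>C\<close>.\<close>
    have "y \<in> U" if "x \<in> K" for x
      using that Basis(2) compactin_subset_topspace[OF K] s by force
    then show ?case
      using K s by (intro exI[of _ K]) blast
  qed simp
  then show thesis using that by blast
qed

text \<open>Each preimage is empty, \<open>A\<close>, its complement or the whole space. With
  \<open>A\<close> a single isolated point this supplies the test functions below.\<close>

lemma continuous_map_clopen_indicator:
  assumes "openin X A" "closedin X A" "a \<in> topspace Y" "b \<in> topspace Y"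
  shows "continuous_map X Y (\<lambda>x. if x \<in> A then a else b)"
proof -
  have "openin X {x \<in> topspace X. (if x \<in> A then a else b) \<in> V}" for V
  proof -
    have "{x \<in> topspace X. (if x \<in> A then a else b) \<in> V} =
        (if a \<in> V then A else {}) \<union> (if b \<in> V then topspace X - A else {})"
      using openin_subset[OF assms(1)] by auto
    then show ?thesis using assms(1,2) by (auto simp: closedin_def)
  qed
  then show ?thesis using assms(3,4) by (simp add: continuous_map_def)
qed

lemma pullback_homeomorphism_imp_compact_covering:
  fixes X :: "'a topology" and Y :: "'b topology"
  assumes ne: "nonisolated_points X \<noteq> {}"
    and U: "y0 \<in> topspace Y" "openin Y U" "y0 \<in> U" "U \<noteq> topspace Y"
    and homeo: "homeomorphic_map
      (pointed_compact_open_topology (isolated_quotient X) {nonisolated_points X} Y y0)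
      (pointed_compact_open_topology X (nonisolated_points X) Y y0)
      (pullback_map X (isolated_collapse X))"
  shows "compact_covering_map X (isolated_quotient X) (isolated_collapse X)"
  unfolding compact_covering_map_def
proof (intro conjI allI impI isolated_collapse_in_topspace)
  let ?Q = "isolated_quotient X" and ?q = "isolated_collapse X" and ?N = "nonisolated_points X"
  let ?P = "pointed_compact_open_topology ?Q {?N} Y y0"
  let ?R = "pointed_compact_open_topology X ?N Y y0"
  fix K assume K: "compactin ?Q K"
  \<comment> \<open>The value that test functions take at one isolated point; it violates membership
    in \<open>U\<close>.\<close>
  obtain y where y: "y \<in> topspace Y" "y \<notin> U"
    using U openin_subset by blast
  obtain p where p: "p \<in> ?N" using ne by blast
  have NX: "?N \<subseteq> topspace X" by (auto simp: nonisolated_points_def)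
  \<comment> \<open>A neighbourhood of the constant map that constrains values on all of
    \<open>K\<close>; its open image upstairs can constrain values near the constant only on some
    compact set.\<close>
  define G where "G = {f \<in> continuous_maps ?Q Y. f ` {?N} \<subseteq> {y0} \<and> f ` K \<subseteq> U}"
  have "openin ?P G"
    unfolding G_def by (rule openin_pointed_compact_open_topology[OF K U(2)])
  then have "openin ?R (pullback_map X ?q ` G)"
    using homeo homeomorphic_imp_open_map open_map_def by blast
  then obtain W where W: "openin (compact_open_topology X Y) W"
    and GW: "pullback_map X ?q ` G = W \<inter> {f. f ` ?N \<subseteq> {y0}}"
    unfolding pointed_compact_open_topology_def openin_subtopology by blast
  have "restrict (\<lambda>_. y0) (topspace ?Q) \<in> G"
  proof -
    have "continuous_map ?Q Y (restrict (\<lambda>_. y0) (topspace ?Q))"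
      by (rule continuous_map_eq[of _ _ "\<lambda>_. y0"]) (use U in auto)
    then show ?thesis
      using compactin_subset_topspace[OF K] U(3) topspace_isolated_quotient[OF ne]
      by (auto simp: G_def continuous_maps_def)
  qed
  moreover have "pullback_map X ?q (restrict (\<lambda>_. y0) (topspace ?Q)) = restrict (\<lambda>_. y0) (topspace X)"
    using isolated_collapse_in_topspace[of X] by (auto simp: pullback_map_def fun_eq_iff)
  ultimately have "restrict (\<lambda>_. y0) (topspace X) \<in> W"
    using GW by (metis IntD1 imageI)
  then obtain C where C: "compactin X C"
    "\<And>f. f \<in> continuous_maps X Y \<Longrightarrow> f ` C \<subseteq> {y0} \<Longrightarrow> f \<in> W"
    using compact_open_neighbourhood_of_constant[OF W] by metis
  have "x \<in> C" if x: "x \<in> isolated_points X" "{x} \<in> K" for x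
  proof (rule ccontr)
    assume "x \<notin> C"
    \<comment> \<open>Equal to \<open>y0\<close> on \<open>C\<close> and on \<open>X'\<close>, so
      \<open>f\<close> lies in the image of \<open>G\<close>. A map of \<open>G\<close> pulling back
      to \<open>f\<close> would take the value \<open>y\<close>, outside \<open>U\<close>, at the
      class \<open>{x}\<close> in \<open>K\<close>.\<close>
    define f where "f = restrict (\<lambda>z. if z \<in> {x} then y else y0) (topspace X)"
    have xX: "x \<in> topspace X" "openin X {x}" "closedin X {x}"
      using x by (auto simp: isolated_points_def)
    have "continuous_map X Y f"
      unfolding f_def
      by (rule continuous_map_eq[OF continuous_map_clopen_indicator[OF xX(2,3) y(1) U(1)]]) simp
    then have "f \<in> continuous_maps X Y"
      by (simp add: continuous_maps_def f_def)
    moreover have "f ` C \<subseteq> {y0}"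
      using \<open>x \<notin> C\<close> compactin_subset_topspace[OF C(1)] by (auto simp: f_def)
    moreover have "f ` ?N \<subseteq> {y0}"
      using x(1) NX by (auto simp: f_def nonisolated_points_def)
    ultimately obtain h where h: "h \<in> G" "f = pullback_map X ?q h"
      using C(2) GW by blast
    have "f x = h {x}"
      using h(2) x(1) xX(1) by (simp add: pullback_map_apply)
    also have "\<dots> \<in> U"
      using h(1) x(2) by (auto simp: G_def)
    finally show False
      using y(2) xX(1) by (simp add: f_def)
  qed
  then have "K \<subseteq> ?q ` insert p C"
  proof -
    have "c \<in> ?q ` insert p C" if "c \<in> K" for c
    proof -
      have "c \<in> insert ?N ((\<lambda>x. {x}) ` isolated_points X)"
        using that compactin_subset_topspace[OF K]
        by (auto simp only: topspace_isolated_quotient[OF ne])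
      then consider "c = ?N" | x where "x \<in> isolated_points X" "c = {x}" by blast
      then show ?thesis
      proof cases
        case 1 then show ?thesis using p by simp
      next
        case (2 x)
        then have "x \<in> C" "?q x = c" using \<open>c \<in> K\<close> \<open>\<And>x. _ \<Longrightarrow> _ \<Longrightarrow> x \<in> C\<close> by auto
        then show ?thesis by blast
      qed
    qed
    then show ?thesis by blast
  qed
  \<comment> \<open>\<open>C\<close> catches all isolated points with class in \<open>K\<close>; the
    point \<open>p\<close> accounts for the class \<open>X'\<close>.\<close>
  moreover have "compactin X (insert p C)"
    using C(1) p NX by (intro compactin_insert) auto
  ultimately show "\<exists>C. compactin X C \<and> K \<subseteq> ?q ` C" by blast
qed

text \<open>Two points with the same class are equal or both in \<open>X'\<close>, where an
  admissible map is constantly \<open>y0\<close>. So the general pullback lemma applies.\<close>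

lemma compact_covering_imp_pullback_homeomorphism:
  assumes ne: "nonisolated_points X \<noteq> {}"
    and cov: "compact_covering_map X (isolated_quotient X) (isolated_collapse X)"
  shows "homeomorphic_map
    (pointed_compact_open_topology (isolated_quotient X) {nonisolated_points X} Y y0)
    (pointed_compact_open_topology X (nonisolated_points X) Y y0)
    (pullback_map X (isolated_collapse X))"
proof -
  let ?N = "nonisolated_points X"
  have "isolated_collapse X ` ?N = {?N}" using ne by auto
  moreover have "homeomorphic_map
      (pointed_compact_open_topology (isolated_quotient X) (isolated_collapse X ` ?N) Y y0)
      (pointed_compact_open_topology X ?N Y y0) (pullback_map X (isolated_collapse X))"
  proof (rule homeomorphic_map_pullback[OF quotient_map_collapse])
    show "\<exists>C. compactin X C \<and> isolated_collapse X ` C = K"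
      if "compactin (isolated_quotient X) K" for K
      using compact_covering_imp_compact_image[OF ne cov that] by blast
    show "?N \<subseteq> topspace X" by (auto simp: nonisolated_points_def)
    show "f x = f z" if "f ` ?N \<subseteq> {y0}" "isolated_collapse X x = isolated_collapse X z"
      for f :: "_ \<Rightarrow> 'b" and x z
    proof (cases "x \<in> ?N \<and> z \<in> ?N")
      case True
      then show ?thesis using that(1) by blast
    next
      case False
      then have "x = z"
        using that(2) by (auto simp: collapse_map_def split: if_splits)
      then show ?thesis by simp
    qed
  qed
  ultimately show ?thesis by simp
qed

section \<open>Every mu-space satisfies (1)\<close>

lemma unbounded_on_isolated_imp_infinite_closed:
  fixes f :: "'a \<Rightarrow> real"
  assumes f: "continuous_map X euclideanreal f" and A: "A \<subseteq> isolated_points X"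
    and unb: "\<not> bounded (f ` A)"
  obtains D where "closedin X D" "D \<subseteq> A" "infinite D"
proof -
  have "\<exists>x\<in>A. real n < \<bar>f x\<bar>" for n :: nat
    using unb by (force simp: bounded_iff not_le)
  then obtain a where a: "\<And>n. a n \<in> A" "\<And>n. real n < \<bar>f (a n)\<bar>" by metis
  have AX: "A \<subseteq> topspace X"
    using A isolated_points_subset_topspace by (rule order_trans)
  have "closedin X (range a)"
    unfolding closedin_def
  proof
    show "range a \<subseteq> topspace X" using a(1) AX by blast
    show "openin X (topspace X - range a)"
    proof (subst openin_subopen, intro ballI)
      fix x assume x: "x \<in> topspace X - range a"
      obtain N :: nat where N: "\<bar>f x\<bar> < real N" using reals_Archimedean2 by blast
      \<comment> \<open>Where \<open>f\<close> stays below \<open>N\<close> in absolute value, no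
        \<open>a n\<close> with \<open>n > N\<close> occurs. The finitely many other terms form a
        closed set, isolated singletons being closed, and their removal keeps
        \<open>x\<close>.\<close>
      define V where "V = {z \<in> topspace X. f z \<in> {- real N<..<real N}} - a ` {..N}"
      have "openin X {z \<in> topspace X. f z \<in> {- real N<..<real N}}"
        by (rule openin_continuous_map_preimage[OF f]) simp
      moreover have "closedin X (a ` {..N})"
      proof -
        have "closedin X (\<Union>n\<in>{..N}. {a n})"
          using a(1) A by (intro closedin_Union) (auto simp: isolated_points_def)
        moreover have "(\<Union>n\<in>{..N}. {a n}) = a ` {..N}" by auto
        ultimately show ?thesis by simp
      qed
      ultimately have "openin X V" unfolding V_def by (rule openin_diff)
      moreover have "x \<in> V" using x N by (auto simp: V_def)
      moreover have "V \<subseteq> topspace X - range a"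
      proof -
        have "a n \<notin> V" for n
          using a(2)[of n] by (cases "n \<le> N") (auto simp: V_def)
        then show ?thesis by (auto simp: V_def)
      qed
      ultimately show "\<exists>T. openin X T \<and> x \<in> T \<and> T \<subseteq> topspace X - range a" by blast
    qed
  qed
  \<comment> \<open>The sequence may repeat points; infinitude of its range comes from the
    unboundedness of \<open>f\<close> along it.\<close>
  moreover have "infinite (range a)"
  proof
    assume "finite (range a)"
    then have "bounded (f ` range a)" by (simp add: finite_imp_bounded)
    then obtain B where B: "\<And>n. \<bar>f (a n)\<bar> \<le> B" by (auto simp: bounded_iff)
    obtain n :: nat where "B < real n" using reals_Archimedean2 by blast
    then show False using a(2)[of n] B[of n] by simp
  qed
  ultimately show thesis using that a(1) by blast
qed

text \<open>For (ii) implies (i) the compact set is the closure of \<open>A\<close>. A real function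
  unbounded on \<open>A\<close> would give an infinite closed subset of \<open>A\<close>, against
  (ii), and boundedness on \<open>A\<close> passes to the closure by continuity.\<close>

lemma mu_space_imp_dot_mu_space:
  assumes "mu_space X"
  shows "dot_mu_space X"
  unfolding dot_mu_space_def
proof (intro allI impI iffI)
  fix A D assume "\<exists>C. compactin X C \<and> A \<subseteq> C" and "closedin X D \<and> D \<subseteq> isolated_points X"
  then show "finite (A \<inter> D)"
    using subset_compactin_Int_closed_isolated_finite by metis
next
  fix A
  assume A: "A \<subseteq> isolated_points X"
    and fin: "\<forall>D. closedin X D \<and> D \<subseteq> isolated_points X \<longrightarrow> finite (A \<inter> D)"
  have "bounded (f ` (X closure_of A))" if f: "continuous_map X euclideanreal f" for f
  proof -
    have "bounded (f ` A)"
    proof (rule ccontr)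
      assume "\<not> bounded (f ` A)"
      then obtain D where "closedin X D" "D \<subseteq> A" "infinite D"
        by (rule unbounded_on_isolated_imp_infinite_closed[OF f A])
      moreover have "A \<inter> D = D" using \<open>D \<subseteq> A\<close> by blast
      ultimately show False using fin A by (metis subset_trans)
    qed
    then have "bounded (closure (f ` A))" by (rule bounded_closure)
    then show ?thesis
      using continuous_map_image_closure_subset[OF f, of A] bounded_subset
      by (simp add: euclidean_closure_of) blast
  qed
  then have "functionally_bounded_in X (X closure_of A)"
    by (simp add: functionally_bounded_in_def closure_of_subset_topspace)
  then have "compactin X (X closure_of A)"
    using assms by (simp add: mu_space_def)
  moreover have "A \<subseteq> X closure_of A"
    using A isolated_points_subset_topspace[of X] by (intro closure_of_subset) (rule order_trans)
  ultimately show "\<exists>C. compactin X C \<and> A \<subseteq> C" by blast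
qed

theorem theorem12p3:
  fixes X :: "'a topology" and Y :: "'b topology" and y0 :: 'b and U :: "'b set"
  defines "X' \<equiv> nonisolated_points X"
  defines "q \<equiv> collapse_map X'"
  defines "Q \<equiv> collapse_topology X X'"
  defines "cond1 \<equiv> dot_mu_space X"
  defines "cond2 \<equiv> compact_covering_map X Q q"
  defines "cond3 \<equiv> homeomorphic_map (pointed_compact_open_topology Q {X'} Y y0)
                                    (pointed_compact_open_topology X X' Y y0)
                                    (pullback_map X q)"
  defines "cond4 \<equiv> mu_space X"
  assumes "y0 \<in> topspace Y"
    and "openin Y U" and "y0 \<in> U" and "U \<noteq> topspace Y"
    and "X \<noteq> discrete_topology (topspace X)"
  shows "(cond1 \<longleftrightarrow> cond2) \<and> (cond2 \<longleftrightarrow> cond3) \<and> (cond4 \<longrightarrow> cond1 \<and> cond2 \<and> cond3)"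
proof -
  have ne: "nonisolated_points X \<noteq> {}"
    using assms(12) by (rule nonisolated_points_nonempty)
  have "cond1 \<longleftrightarrow> cond2"
    unfolding cond1_def cond2_def Q_def q_def X'_def
    by (rule dot_mu_space_iff_compact_covering[OF ne])
  \<comment> \<open>The proper neighbourhood \<open>U\<close> of \<open>y0\<close> serves the
    passage from (3) to (2), where it detects the test functions.\<close>
  moreover have "cond2 \<longleftrightarrow> cond3"
    unfolding cond2_def cond3_def Q_def q_def X'_def
    by (rule iffI[OF compact_covering_imp_pullback_homeomorphism[OF ne]
          pullback_homeomorphism_imp_compact_covering[OF ne assms(8-11)]])
  moreover have "cond4 \<longrightarrow> cond1"
    unfolding cond1_def cond4_def using mu_space_imp_dot_mu_space by blast
  ultimately show ?thesis by blast
qed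

end
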